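(* Let $\epsilon\in(0,1/2)$ and $\kappa=-\varPhi^{-1}(\epsilon)>0$, where $\varPhi$ is the cumulative distribution function of the standard normal distribution. Let $g:\mathbb{R}^n\to\mathbb{R}$ be differentiable and $X\subseteq\mathbb{R}^n$ a closed set. Let $\tilde{\boldsymbol{\mu}}\in\mathbb{R}^n$, let $\tilde{\varSigma}\in\mathcal{S}^n$ be positive definite, let $A\in\mathbb{R}^{n\times m}$, $B\in\mathbb{R}^{n\times k}$, $\alpha\ge 0$, $\beta\ge 0$, and define $$U_{\boldsymbol{\mu}}=\{\tilde{\boldsymbol{\mu}}+A\boldsymbol{z}_1\mid\|\boldsymbol{z}_1\|_\infty\le\alpha,\ \boldsymbol{z}_1\in\mathbb{R}^m\},$$ $$U_{\varSigma}=\{\tilde{\varSigma}+BZ_2B^{\top}\mid\|Z_2\|_{\infty,\infty}\le\beta,\ Z_2\in\mathcal{S}^k\}\cap\mathcal{S}_+^n .$$ Then $\tilde{\boldsymbol{x}}\in X$ satisfies $$\mathrm{P}_{\mathsf{N}(\boldsymbol{\mu},\varSigma)}\{g(\tilde{\boldsymbol{x}})+\nabla g(\tilde{\boldsymbol{x}})^{\top}\boldsymbol{\zeta}\le 0\}\ge 1-\epsilon\quad\text{for all }\boldsymbol{\mu}\in U_{\boldsymbol{\mu}}\text{ and all }\varSigma\in U_{\varSigma}$$ if and only if there exists a pair of $z\in\mathbb{R}$ and $W\in\mathcal{S}^n$ satisfying $$g(\tilde{\boldsymbol{x}})+\nabla g(\tilde{\boldsymbol{x}})^{\top}\tilde{\boldsymbol{\mu}}+\alpha\|A^{\top}\nabla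 g(\tilde{\boldsymbol{x}})\|_1+\tilde{\varSigma}\bullet W+\beta\|B^{\top}WB\|_{1,1}+\kappa^2 z\le 0,$$ $$\begin{bmatrix}W & \nabla g(\tilde{\boldsymbol{x}})/2\\ \nabla g(\tilde{\boldsymbol{x}})^{\top}/2 & z\end{bmatrix}\succeq 0 .$$
   Context: $\mathcal{S}^n$ is the set of real symmetric $n\times n$ matrices; $Z\succeq 0$ means $Z$ is symmetric positive semidefinite, and $\mathcal{S}_+^n=\{Z\in\mathcal{S}^n\mid Z\succeq 0\}$. $X\bullet Y=\mathrm{tr}(X^{\top}Y)$. For vectors, $\|\boldsymbol{x}\|_1=\sum_i|x_i|$ and $\|\boldsymbol{x}\|_\infty=\max_i|x_i|$; for matrices, $\|X\|_{1,1}=\sum_{i,j}|X_{ij}|$ and $\|X\|_{\infty,\infty}=\max_{i,j}|X_{ij}|$. $\mathsf{N}(\boldsymbol{\mu},\varSigma)$ denotes the (possibly degenerate, if $\varSigma$ is singular) multivariate normal distribution on $\mathbb{R}^n$ with expected value vector $\boldsymbol{\mu}$ and variance-covariance matrix $\varSigma$, and $\mathrm{P}_{\mathsf{N}(\boldsymbol{\mu},\varSigma)}\{\cdot\}$ denotes probability when the random vector $\boldsymbol{\zeta}$ is distributed as $\mathsf{N}(\boldsymbol{\mu},\varSigma)$; $\tilde{\boldsymbol{x}}$ is non-random. *)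

theory Defs
  imports "HOL-Probability.Probability"
begin

definition symmetric_matrix :: "real^'n^'n \<Rightarrow> bool" where
  "symmetric_matrix Z \<longleftrightarrow> transpose Z = Z"

definition psd :: "real^'n^'n \<Rightarrow> bool" where
  "psd Z \<longleftrightarrow> symmetric_matrix Z \<and> (\<forall>v. 0 \<le> v \<bullet> (Z *v v))"

definition pos_def :: "real^'n^'n \<Rightarrow> bool" where
  "pos_def Z \<longleftrightarrow> symmetric_matrix Z \<and> (\<forall>v. v \<noteq> 0 \<longrightarrow> 0 < v \<bullet> (Z *v v))"

definition mat_inner :: "real^'n^'m \<Rightarrow> real^'n^'m \<Rightarrow> real" where
  "mat_inner X Y = trace (transpose X ** Y)"

text \<open>The library's \<open>norm\<close> on vectors and matrices is Euclidean (Frobenius); its maximum norm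
  on vectors is \<open>infnorm\<close>.\<close>

definition vec_norm_1 :: "real^'n \<Rightarrow> real" where
  "vec_norm_1 x = (\<Sum>i\<in>UNIV. \<bar>x $ i\<bar>)"

definition mat_norm_1_1 :: "real^'n^'m \<Rightarrow> real" where
  "mat_norm_1_1 X = (\<Sum>i\<in>UNIV. \<Sum>j\<in>UNIV. \<bar>X $ i $ j\<bar>)"

definition mat_norm_inf_inf :: "real^'n^'m \<Rightarrow> real" where
  "mat_norm_inf_inf X = Max {\<bar>X $ i $ j\<bar> | i j. True}"

text \<open>Meaningful only where \<open>g\<close> is differentiable; the gradient is then unique.\<close>

definition gradient :: "('a::real_inner \<Rightarrow> real) \<Rightarrow> 'a \<Rightarrow> 'a" where
  "gradient g x = (THE D. GDERIV g x :> D)"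

text \<open>The symmetric block matrix with diagonal blocks \<open>W\<close> and \<open>z\<close> and off-diagonal blocks \<open>v\<close> and
  the transpose of \<open>v\<close>. Its rows and columns are indexed by \<open>'n + unit\<close>, the right summand being
  the additional last index.\<close>

definition bordered_matrix :: "real^'n^'n \<Rightarrow> real^'n \<Rightarrow> real \<Rightarrow> real^('n + unit)^('n + unit)" where
  "bordered_matrix W v z = (\<chi> p q.
     case p of
       Inl i \<Rightarrow> (case q of Inl j \<Rightarrow> W $ i $ j | Inr _ \<Rightarrow> v $ i)
     | Inr _ \<Rightarrow> (case q of Inl j \<Rightarrow> v $ j | Inr _ \<Rightarrow> z))"

text \<open>The normal distribution \<open>N(\<mu>, \<Sigma>)\<close>, degenerate if \<open>\<Sigma>\<close> is singular, is the law of
  \<open>\<mu> + L \<xi>\<close>, where the components of \<open>\<xi>\<close> are independent standard normal variables and \<open>L\<close> is a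
  square matrix with \<open>L L\<^sup>T = \<Sigma>\<close>. For positive semidefinite \<open>\<Sigma>\<close> such an \<open>L\<close> exists (for instance
  the symmetric square root), and the law does not depend on the choice of \<open>L\<close>; for any other
  \<open>\<Sigma>\<close> the definition is meaningless.\<close>

definition multivariate_normal :: "real^'n \<Rightarrow> real^'n^'n \<Rightarrow> (real^'n) measure" where
  "multivariate_normal \<mu> \<Sigma> =
     (let L = (SOME L :: real^'n^'n. L ** transpose L = \<Sigma>)
      in distr (\<Pi>\<^sub>M i\<in>(UNIV :: 'n set). std_normal_distribution) borel
           (\<lambda>\<xi>. \<mu> + L *v (\<chi> i. \<xi> i)))"

end

theory Submission
  imports Defs
begin

text \<open>For fixed \<open>\<mu>\<close> and \<open>\<Sigma>\<close> the chance constraint on a linear function with gradient \<open>a\<close> is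
  \<open>g + a \<bullet> \<mu> + \<kappa> * sqrt (a \<bullet> \<Sigma> a) \<le> 0\<close>. The worst \<open>\<mu>\<close> contributes the 1-norm by duality of the
  norms. For the worst \<open>\<Sigma>\<close> one maximizes the linear function \<open>a \<bullet> \<Sigma> a\<close> of \<open>\<Sigma>\<close> over a set that has
  the positive definite Slater point \<open>\<Sigma>t\<close>, so there is a multiplier \<open>P \<succeq> 0\<close>
  for the constraint \<open>\<Sigma> \<succeq> 0\<close>. The certificate is then \<open>W = (a a\<^sup>T + P) / (4 z)\<close> with \<open>z\<close> chosen to
  give equality in \<open>h / (4 z) + \<kappa>\<^sup>2 z \<ge> \<kappa> * sqrt h\<close>, where \<open>h\<close> bounds \<open>a \<bullet> \<Sigma> a\<close>. Conversely, the
  quadratic form of the bordered matrix is tested at the vector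
  \<open>(\<Sigma> a / sqrt (a \<bullet> \<Sigma> a), - \<kappa>)\<close>.\<close>

subsection \<open>Positive semidefinite matrices\<close>

definition outer_square :: "real^'n \<Rightarrow> real^'n^'n" where
  "outer_square u = (\<chi> i j. u $ i * u $ j)"

text \<open>The library inner product on nested vectors is the trace form, so Euclidean results such
  as hyperplane separation apply to matrices.\<close>

lemma mat_inner_eq_inner: "mat_inner X Y = X \<bullet> Y"
proof -
  have "mat_inner X Y = (\<Sum>i\<in>UNIV. \<Sum>k\<in>UNIV. X $ k $ i * Y $ k $ i)"
    by (simp add: mat_inner_def trace_def matrix_matrix_mult_def transpose_def)
  also have "\<dots> = (\<Sum>k\<in>UNIV. \<Sum>i\<in>UNIV. X $ k $ i * Y $ k $ i)"
    by (rule sum.swap)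
  finally show ?thesis by (simp add: inner_vec_def)
qed

lemma inner_matrix_vector_transpose: "u \<bullet> (Z *v v) = (transpose Z *v u) \<bullet> v"
  for Z :: "real^'n^'m"
  by (metis dot_lmul_matrix inner_commute matrix_transpose_mul transpose_matrix_vector)

lemma symmetric_matrix_inner: "symmetric_matrix Z \<Longrightarrow> u \<bullet> (Z *v v) = v \<bullet> (Z *v u)"
  unfolding symmetric_matrix_def by (metis inner_matrix_vector_transpose inner_commute)

lemma symmetric_matrix_iff: "symmetric_matrix Z \<longleftrightarrow> (\<forall>i j. Z $ i $ j = Z $ j $ i)"
  by (auto simp: symmetric_matrix_def transpose_def vec_eq_iff)

lemma outer_square_0 [simp]: "outer_square 0 = 0"
  by (simp add: outer_square_def vec_eq_iff)

lemma symmetric_outer_square: "symmetric_matrix (outer_square u)"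
  by (simp add: symmetric_matrix_iff outer_square_def mult.commute)

lemma outer_square_mult_vec: "outer_square u *v v = (u \<bullet> v) *\<^sub>R u"
  by (simp add: outer_square_def matrix_vector_mult_def vec_eq_iff inner_vec_def
      sum_distrib_left mult_ac)

lemma inner_outer_square: "W \<bullet> outer_square u = u \<bullet> (W *v u)"
  by (simp add: outer_square_def matrix_vector_mult_def inner_vec_def
      sum_distrib_left mult_ac)

lemma inner_outer_square': "outer_square u \<bullet> W = u \<bullet> (W *v u)"
  by (simp add: inner_commute[of _ W] inner_outer_square)

lemma psd_outer_square: "psd (outer_square u)"
  by (simp add: psd_def symmetric_outer_square outer_square_mult_vec inner_commute)

lemma quadratic_form_diff_scaleR:
  assumes "symmetric_matrix Z"
  shows "(v - t *\<^sub>R w) \<bullet> (Z *v (v - t *\<^sub>R w))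
    = v \<bullet> (Z *v v) - 2 * t * (v \<bullet> (Z *v w)) + t\<^sup>2 * (w \<bullet> (Z *v w))"
  using symmetric_matrix_inner[OF assms, of w v]
  by (simp add: matrix_vector_mult_diff_distrib matrix_vector_mult_scaleR inner_diff
      algebra_simps power2_eq_square)

text \<open>The quadratic form at \<open>v - t *\<^sub>R w\<close> is nonnegative for every
  \<open>t\<close>; for \<open>q > 0\<close> the inequality is read off at the minimizer
  \<open>t = p / q\<close>.\<close>

lemma psd_Cauchy_Schwarz:
  assumes "psd Z"
  shows "(v \<bullet> (Z *v w))\<^sup>2 \<le> (v \<bullet> (Z *v v)) * (w \<bullet> (Z *v w))"
proof -
  define p q where "p = v \<bullet> (Z *v w)" and "q = w \<bullet> (Z *v w)"
  have sym: "symmetric_matrix Z" and nonneg: "\<And>x. 0 \<le> x \<bullet> (Z *v x)"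
    using assms by (auto simp: psd_def)
  have ge: "0 \<le> v \<bullet> (Z *v v) - 2 * t * p + t\<^sup>2 * q" for t
    using nonneg[of "v - t *\<^sub>R w"] unfolding quadratic_form_diff_scaleR[OF sym] p_def q_def .
  have "p\<^sup>2 \<le> (v \<bullet> (Z *v v)) * q"
  proof (cases "q = 0")
    case True
    have "p = 0"
    proof (rule ccontr)
      assume "p \<noteq> 0"
      then show False
        \<comment> \<open>This \<open>t\<close> gives the value -1 to the affine function of
          \<open>t\<close> that remains when \<open>q = 0\<close>.\<close>
        using ge[of "(v \<bullet> (Z *v v) + 1) / (2 * p)"] True by (simp add: field_simps)
    qed
    then show ?thesis using True by simp
  next
    case False
    then have "q > 0" using nonneg[of w] by (simp add: q_def)
    then show ?thesis
      using ge[of "p / q"] by (simp add: field_simps power2_eq_square)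
  qed
  then show ?thesis by (simp add: p_def q_def)
qed

text \<open>Cauchy-Schwarz against \<open>Z *v w\<close> itself bounds the fourth power of its norm
  by 0.\<close>

lemma psd_eq_0:
  assumes "psd Z" "w \<bullet> (Z *v w) = 0"
  shows "Z *v w = 0"
  using psd_Cauchy_Schwarz[OF assms(1), of "Z *v w" w] assms(2) by simp

text \<open>One Cholesky step: subtracting a rank-one square adds \<open>w\<close> to the kernel and
  keeps the kernel found so far. Cauchy-Schwarz keeps the remainder semidefinite. If
  \<open>w \<bullet> (Z *v w) = 0\<close>, the convention \<open>inverse 0 = 0\<close> makes
  \<open>u w = 0\<close>.\<close>

lemma psd_deflate:
  assumes "psd Z"
  defines "u \<equiv> \<lambda>w. (Z *v w) /\<^sub>R sqrt (w \<bullet> (Z *v w))"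
  shows "psd (Z - outer_square (u w))"
    and "(Z - outer_square (u w)) *v w = 0"
    and "Z *v x = 0 \<Longrightarrow> (Z - outer_square (u w)) *v x = 0"
    and "u w \<bullet> w = sqrt (w \<bullet> (Z *v w))"
proof -
  have sym: "symmetric_matrix Z" and nonneg: "\<And>x. 0 \<le> x \<bullet> (Z *v x)"
    using assms by (auto simp: psd_def)
  define q where "q = w \<bullet> (Z *v w)"
  have q0: "q \<ge> 0" using nonneg by (simp add: q_def)
  show 4: "u w \<bullet> w = sqrt (w \<bullet> (Z *v w))"
    using q0 by (simp add: u_def inner_commute q_def[symmetric] real_div_sqrt
        divide_inverse_commute[symmetric])
  have mv: "(Z - outer_square (u w)) *v x = Z *v x - (u w \<bullet> x) *\<^sub>R u w" for x
    by (simp add: matrix_vector_mult_diff_rdistrib outer_square_mult_vec)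
  have ux: "u w \<bullet> x = (x \<bullet> (Z *v w)) / sqrt q" for x
    by (simp add: u_def q_def inner_commute divide_inverse_commute)
  show "psd (Z - outer_square (u w))"
    unfolding psd_def
  proof (intro conjI allI)
    show "symmetric_matrix (Z - outer_square (u w))"
      using sym symmetric_outer_square[of "u w"] by (simp add: symmetric_matrix_iff)
    fix x
    have "(x \<bullet> (Z *v w))\<^sup>2 / q \<le> x \<bullet> (Z *v x)"
      using psd_Cauchy_Schwarz[OF assms(1), of x w] q0 nonneg[of x]
      by (cases "q = 0") (auto simp: q_def[symmetric] field_simps)
    then show "0 \<le> x \<bullet> ((Z - outer_square (u w)) *v x)"
      using q0 by (simp add: mv inner_diff_right inner_commute[of x "u w"] ux
          power2_eq_square[symmetric] power_divide)
  qed
  show "(Z - outer_square (u w)) *v w = 0"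
  proof (cases "q = 0")
    case True
    then show ?thesis using psd_eq_0[OF assms(1), of w] by (simp add: q_def u_def)
  next
    case False
    then show ?thesis using 4 by (simp add: mv q_def[symmetric]) (simp add: u_def q_def)
  qed
  show "(Z - outer_square (u w)) *v x = 0" if "Z *v x = 0"
    using that symmetric_matrix_inner[OF sym, of x w] by (simp add: mv ux)
qed

text \<open>Cholesky: deflating along the unit vectors one after the other leaves a matrix that
  annihilates all of them.\<close>

lemma psd_eq_sum_outer_square:
  fixes Z :: "real^'n^'n"
  assumes "psd Z"
  obtains u :: "'n \<Rightarrow> real^'n" where "Z = (\<Sum>i\<in>UNIV. outer_square (u i))"
proof -
  have "\<exists>u. psd (Z - (\<Sum>i\<in>I. outer_square (u i))) \<and>
      (\<forall>i\<in>I. (Z - (\<Sum>i\<in>I. outer_square (u i))) *v axis i 1 = 0)"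
    if "finite I" for I :: "'n set"
    using that
  proof (induction I)
    case empty
    then show ?case using assms by simp
  next
    case (insert k I)
    then obtain u where u: "psd (Z - (\<Sum>i\<in>I. outer_square (u i)))"
      "\<And>i. i \<in> I \<Longrightarrow> (Z - (\<Sum>i\<in>I. outer_square (u i))) *v axis i 1 = 0"
      by blast
    define R where "R = Z - (\<Sum>i\<in>I. outer_square (u i))"
    define w where "w = (R *v axis k 1) /\<^sub>R sqrt (axis k 1 \<bullet> (R *v axis k 1))"
    have "(\<Sum>i\<in>I. outer_square ((u(k := w)) i)) = (\<Sum>i\<in>I. outer_square (u i))"
      using insert.hyps by (intro sum.cong) auto
    then have eq: "Z - (\<Sum>i\<in>insert k I. outer_square ((u(k := w)) i)) = R - outer_square w"
      using insert.hyps by (simp add: R_def)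
    show ?case
      using psd_deflate(1,2)[OF u(1)[folded R_def], of "axis k 1", folded w_def]
        psd_deflate(3)[OF u(1)[folded R_def] u(2)[folded R_def], of _ "axis k 1", folded w_def]
      by (intro exI[of _ "u(k := w)"]) (simp add: eq del: fun_upd_apply)
  qed
  from this[OF finite] obtain u :: "'n \<Rightarrow> real^'n"
    where u: "\<And>i. (Z - (\<Sum>i\<in>UNIV. outer_square (u i))) *v axis i 1 = 0"
    by blast
  have "Z - (\<Sum>i\<in>UNIV. outer_square (u i)) = 0"
    using u unfolding matrix_vector_mult_basis by (simp add: vec_eq_iff column_def)
  then show ?thesis by (intro that[of u]) simp
qed

text \<open>The vectors of the decomposition are the columns of \<open>L\<close>. Existence makes
  the choice of \<open>L\<close> in \<open>multivariate_normal\<close> meaningful.\<close>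

lemma psd_factorization:
  fixes Z :: "real^'n^'n"
  assumes "psd Z"
  shows "\<exists>L :: real^'n^'n. L ** transpose L = Z"
proof -
  obtain u :: "'n \<Rightarrow> real^'n" where u: "Z = (\<Sum>i\<in>UNIV. outer_square (u i))"
    using psd_eq_sum_outer_square[OF assms] .
  have "(\<chi> i k. u k $ i) ** transpose (\<chi> i k. u k $ i) = Z"
    by (simp add: u matrix_matrix_mult_def transpose_def outer_square_def vec_eq_iff)
  then show ?thesis ..
qed

text \<open>Decomposing \<open>Z\<close> turns the inner product into a sum of values of the
  quadratic form of \<open>W\<close>.\<close>

lemma psd_inner_nonneg:
  fixes Z :: "real^'n^'n"
  assumes "psd Z" "psd W"
  shows "0 \<le> Z \<bullet> W"
proof -
  obtain u :: "'n \<Rightarrow> real^'n" where u: "Z = (\<Sum>i\<in>UNIV. outer_square (u i))"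
    using psd_eq_sum_outer_square[OF assms(1)] .
  show ?thesis
    using assms(2) unfolding u inner_sum_left
    by (intro sum_nonneg) (simp add: inner_outer_square' psd_def)
qed

text \<open>Each rank-one summand of \<open>Z\<close> pairs strictly positively with
  \<open>W\<close> unless it is 0. Slater's condition uses this to rule out a vanishing multiplier
  of the objective.\<close>

lemma psd_inner_pos_def_eq_0:
  fixes Z :: "real^'n^'n"
  assumes "psd Z" "pos_def W" "Z \<bullet> W \<le> 0"
  shows "Z = 0"
proof -
  obtain u :: "'n \<Rightarrow> real^'n" where u: "Z = (\<Sum>i\<in>UNIV. outer_square (u i))"
    using psd_eq_sum_outer_square[OF assms(1)] .
  have W: "0 < v \<bullet> (W *v v)" if "v \<noteq> 0" for v
    using assms(2) that by (simp add: pos_def_def)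
  have nonneg: "0 \<le> outer_square (u i) \<bullet> W" for i
    using W[of "u i"] by (cases "u i = 0") (auto simp: inner_outer_square')
  have "(\<Sum>i\<in>UNIV. outer_square (u i) \<bullet> W) = 0"
    using assms(3) nonneg by (simp add: u inner_sum_left order_antisym sum_nonneg)
  then have "outer_square (u i) \<bullet> W = 0" for i
    using nonneg by (simp add: sum_nonneg_eq_0_iff)
  then have "u i = 0" for i
    using W[of "u i"] by (cases "u i = 0") (auto simp: inner_outer_square')
  then show ?thesis by (simp add: u outer_square_def vec_eq_iff)
qed

lemma pos_def_imp_psd: "pos_def Z \<Longrightarrow> psd Z"
  unfolding pos_def_def psd_def by (metis inner_zero_left less_eq_real_def)

subsection \<open>Semidefinite duality\<close>

text \<open>An antisymmetric matrix has zero quadratic form, hence may serve as \<open>Q\<close>.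
  For \<open>K = transpose P - P\<close> the product \<open>P \<bullet> K\<close> is -1/2 times
  \<open>K \<bullet> K\<close>, which forces \<open>K = 0\<close>.\<close>

lemma symmetric_of_inner_nonneg:
  fixes P :: "real^'n^'n"
  assumes "\<And>Q. (\<And>v. 0 \<le> v \<bullet> (Q *v v)) \<Longrightarrow> 0 \<le> P \<bullet> Q"
  shows "symmetric_matrix P"
proof -
  define K where "K = transpose P - P"
  have "v \<bullet> (K *v v) = 0" for v
    by (simp add: K_def matrix_vector_mult_diff_rdistrib inner_diff_right
        inner_matrix_vector_transpose[of v P] inner_commute)
  then have "0 \<le> P \<bullet> K" by (intro assms) simp
  moreover have "transpose P \<bullet> transpose P = P \<bullet> P"
    using sum.swap[of "\<lambda>i j. P $ j $ i * P $ j $ i" UNIV UNIV]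
    by (simp add: inner_vec_def transpose_def)
  ultimately have "K \<bullet> K \<le> 0"
    by (simp add: K_def inner_diff_left inner_diff_right inner_commute)
  then have "K = 0"
    using inner_ge_zero[of K] by (metis inner_eq_zero_iff order_antisym)
  then show ?thesis by (simp add: K_def symmetric_matrix_def)
qed

section \<open>Duality of the maximum norm and the entrywise 1-norm\<close>

lemma mat_norm_inf_inf_le_iff:
  "mat_norm_inf_inf X \<le> b \<longleftrightarrow> (\<forall>i j. \<bar>X $ i $ j\<bar> \<le> b)"
proof -
  have eq: "{\<bar>X $ i $ j\<bar> | i j. True} = (\<lambda>(i, j). \<bar>X $ i $ j\<bar>) ` UNIV"
    by auto
  show ?thesis unfolding mat_norm_inf_inf_def eq by auto
qed

lemma infnorm_le_iff_cart: "infnorm x \<le> b \<longleftrightarrow> (\<forall>i. \<bar>x $ i\<bar> \<le> b)"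
  for x :: "real^'n"
proof
  show "infnorm x \<le> b \<Longrightarrow> \<forall>i. \<bar>x $ i\<bar> \<le> b"
    using component_le_infnorm_cart order_trans by blast
  show "\<forall>i. \<bar>x $ i\<bar> \<le> b \<Longrightarrow> infnorm x \<le> b"
    unfolding infnorm_cart by (intro cSup_least) auto
qed

lemma inner_le_vec_norm_1:
  fixes x y :: "real^'n"
  assumes "infnorm y \<le> b"
  shows "x \<bullet> y \<le> b * vec_norm_1 x"
proof -
  have "x $ i * y $ i \<le> b * \<bar>x $ i\<bar>" for i
  proof -
    have "x $ i * y $ i \<le> \<bar>x $ i\<bar> * \<bar>y $ i\<bar>" by (simp add: abs_mult[symmetric])
    also have "\<dots> \<le> \<bar>x $ i\<bar> * b"
      using assms by (intro mult_left_mono) (auto simp: infnorm_le_iff_cart)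
    finally show ?thesis by (simp add: mult.commute)
  qed
  then show ?thesis
    by (simp add: inner_vec_def vec_norm_1_def sum_distrib_left sum_mono)
qed

lemma vec_norm_1_attained:
  fixes x :: "real^'n"
  assumes "0 \<le> b"
  obtains y where "infnorm y \<le> b" "x \<bullet> y = b * vec_norm_1 x"
proof
  show "infnorm (\<chi> i. b * sgn (x $ i)) \<le> b"
    using assms by (auto simp: infnorm_le_iff_cart abs_mult sgn_if)
  show "x \<bullet> (\<chi> i. b * sgn (x $ i)) = b * vec_norm_1 x"
    by (simp add: inner_vec_def vec_norm_1_def sum_distrib_left abs_sgn mult_ac)
qed

lemma inner_le_mat_norm_1_1:
  fixes X Y :: "real^'n^'m"
  assumes "mat_norm_inf_inf Y \<le> b"
  shows "X \<bullet> Y \<le> b * mat_norm_1_1 X"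
proof -
  have "X $ i $ j * Y $ i $ j \<le> b * \<bar>X $ i $ j\<bar>" for i j
  proof -
    have "X $ i $ j * Y $ i $ j \<le> \<bar>X $ i $ j\<bar> * \<bar>Y $ i $ j\<bar>" by (simp add: abs_mult[symmetric])
    also have "\<dots> \<le> \<bar>X $ i $ j\<bar> * b"
      using assms by (intro mult_left_mono) (auto simp: mat_norm_inf_inf_le_iff)
    finally show ?thesis by (simp add: mult.commute)
  qed
  then show ?thesis
    by (simp add: inner_vec_def mat_norm_1_1_def sum_distrib_left sum_mono)
qed

text \<open>The sign pattern of \<open>X\<close>, scaled by \<open>b\<close>, gives equality; it
  inherits symmetry from \<open>X\<close>, so the maximizer stays among the symmetric
  matrices.\<close>

lemma mat_norm_1_1_attained:
  fixes X :: "real^'n^'n"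
  assumes "0 \<le> b" "symmetric_matrix X"
  obtains Y where "mat_norm_inf_inf Y \<le> b" "symmetric_matrix Y" "X \<bullet> Y = b * mat_norm_1_1 X"
proof
  show "mat_norm_inf_inf (\<chi> i j. b * sgn (X $ i $ j)) \<le> b"
    using assms by (auto simp: mat_norm_inf_inf_le_iff abs_mult sgn_if)
  show "symmetric_matrix (\<chi> i j. b * sgn (X $ i $ j))"
    using assms(2) by (simp add: symmetric_matrix_iff)
  show "X \<bullet> (\<chi> i j. b * sgn (X $ i $ j)) = b * mat_norm_1_1 X"
    by (simp add: inner_vec_def mat_norm_1_1_def sum_distrib_left abs_sgn mult_ac)
qed

lemma mat_norm_1_1_scaleR: "mat_norm_1_1 (c *\<^sub>R X) = \<bar>c\<bar> * mat_norm_1_1 X"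
  by (simp add: mat_norm_1_1_def abs_mult sum_distrib_left)

section \<open>Congruences and adjoints\<close>

lemma matrix_matrix_add_rdistrib: "(X + Y) ** Z = X ** Z + Y ** Z"
  for X Y :: "real^'n^'m" and Z :: "real^'k^'n"
  by (simp add: matrix_matrix_mult_def vec_eq_iff distrib_right sum.distrib)

lemma inner_matrix_mult_left: "(X ** Y) \<bullet> W = Y \<bullet> (transpose X ** W)"
  for X :: "real^'n^'m" and Y :: "real^'k^'n"
  by (simp add: mat_inner_eq_inner[symmetric] mat_inner_def matrix_transpose_mul matrix_mul_assoc)

lemma inner_matrix_mult_right: "(X ** Y) \<bullet> W = X \<bullet> (W ** transpose Y)"
  for X :: "real^'n^'m" and Y :: "real^'k^'n"
  using trace_mul_sym[of "transpose Y" "transpose X ** W"]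
  by (simp add: mat_inner_eq_inner[symmetric] mat_inner_def matrix_transpose_mul matrix_mul_assoc)

text \<open>The map sending \<open>W\<close> to \<open>transpose B ** W ** B\<close> is the adjoint
  of the perturbation map; this is why the 1-norm of that matrix enters the constraint.\<close>

lemma inner_congruence: "(B ** Y ** transpose B) \<bullet> W = Y \<bullet> (transpose B ** W ** B)"
  for B :: "real^'k^'n"
  by (simp add: inner_matrix_mult_left[of B Y] inner_matrix_mult_right[of "B ** Y"]
      matrix_mul_assoc)

lemma symmetric_congruence:
  "symmetric_matrix Y \<Longrightarrow> symmetric_matrix (B ** Y ** transpose B)"
  by (simp add: symmetric_matrix_def matrix_transpose_mul matrix_mul_assoc)

lemma symmetric_matrix_add:
  "symmetric_matrix X \<Longrightarrow> symmetric_matrix Y \<Longrightarrow> symmetric_matrix (X + Y)"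
  by (simp add: symmetric_matrix_iff)

section \<open>Bordered matrices as quadratic forms\<close>

lemma quadratic_form_bordered_matrix:
  fixes W :: "real^'n^'n"
  shows "x \<bullet> (bordered_matrix W v z *v x) =
    (\<chi> i. x $ Inl i) \<bullet> (W *v (\<chi> i. x $ Inl i))
      + 2 * (x $ Inr ()) * (v \<bullet> (\<chi> i. x $ Inl i)) + z * (x $ Inr ())\<^sup>2"
proof -
  have sum_split: "(\<Sum>p\<in>UNIV. f p) = (\<Sum>i\<in>UNIV. f (Inl i)) + f (Inr ())" for f :: "'n + unit \<Rightarrow> real"
    by (simp add: UNIV_sum UNIV_unit sum.reindex image_iff add.commute)
  show ?thesis
    by (simp add: inner_vec_def matrix_vector_mult_def bordered_matrix_def sum_split
        distrib_left sum.distrib sum_distrib_left power2_eq_square mult_ac)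
qed

lemma symmetric_bordered_matrix:
  "symmetric_matrix W \<Longrightarrow> symmetric_matrix (bordered_matrix W v z)"
  by (auto simp: symmetric_matrix_iff bordered_matrix_def split: sum.splits)

lemma psd_bordered_matrixI:
  fixes W :: "real^'n^'n"
  assumes "symmetric_matrix W"
    and "\<And>x t. 0 \<le> x \<bullet> (W *v x) + 2 * t * (v \<bullet> x) + z * t\<^sup>2"
  shows "psd (bordered_matrix W v z)"
  using assms by (simp add: psd_def symmetric_bordered_matrix quadratic_form_bordered_matrix)

lemma psd_bordered_matrixD:
  fixes W :: "real^'n^'n"
  assumes "psd (bordered_matrix W v z)"
  shows "0 \<le> x \<bullet> (W *v x) + 2 * t * (v \<bullet> x) + z * t\<^sup>2"
proof -
  define y :: "real^('n + unit)" where "y = (\<chi> p. case p of Inl i \<Rightarrow> x $ i | Inr _ \<Rightarrow> t)"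
  have "0 \<le> y \<bullet> (bordered_matrix W v z *v y)"
    using assms by (simp add: psd_def)
  then show ?thesis
    by (simp add: quadratic_form_bordered_matrix) (simp add: y_def)
qed

section \<open>Weak and strong duality\<close>

text \<open>Deflating \<open>S\<close> along \<open>a\<close> leaves a semidefinite matrix, whose
  product with \<open>W\<close> is nonnegative, so
  \<open>u \<bullet> (W *v u) \<le> S \<bullet> W\<close>. The bordered form at
  \<open>(u, - \<kappa>)\<close> then gives the bound, because \<open>u \<bullet> a\<close> is the
  standard deviation \<open>sqrt (a \<bullet> (S *v a))\<close>.\<close>

lemma sdp_weak_duality:
  fixes a :: "real^'n"
  assumes "psd S" "symmetric_matrix W" "psd (bordered_matrix W (a /\<^sub>R 2) z)"
  shows "\<kappa> * sqrt (a \<bullet> (S *v a)) \<le> S \<bullet> W + \<kappa>\<^sup>2 * z"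
proof -
  define u where "u = (S *v a) /\<^sub>R sqrt (a \<bullet> (S *v a))"
  have bordered: "0 \<le> x \<bullet> (W *v x) + t * (a \<bullet> x) + z * t\<^sup>2" for x t
    using psd_bordered_matrixD[OF assms(3), of x t] by simp
  have "psd W"
    using bordered[of _ 0] assms(2) by (simp add: psd_def)
  then have "0 \<le> (S - outer_square u) \<bullet> W"
    using psd_deflate(1)[OF assms(1), of a] unfolding u_def by (intro psd_inner_nonneg)
  then have "u \<bullet> (W *v u) \<le> S \<bullet> W"
    by (simp add: inner_diff_left inner_outer_square')
  moreover have "u \<bullet> a = sqrt (a \<bullet> (S *v a))"
    using psd_deflate(4)[OF assms(1), of a] by (simp add: u_def)
  ultimately show ?thesis
    using bordered[of u "- \<kappa>"] by (simp add: inner_commute mult.commute)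
qed

text \<open>Lagrange duality: separating the origin from a convex set of constraint and objective
  values yields a multiplier for semidefiniteness. Maximizing the resulting linear function over the
  box of \<open>Y\<close> gives the 1-norm.\<close>

lemma sdp_strong_duality:
  fixes C S :: "real^'n^'n" and B :: "real^'k^'n"
  assumes "pos_def S" "symmetric_matrix C" "0 \<le> \<beta>"
    and bound: "\<And>Y. mat_norm_inf_inf Y \<le> \<beta> \<Longrightarrow> symmetric_matrix Y \<Longrightarrow>
      psd (S + B ** Y ** transpose B) \<Longrightarrow> C \<bullet> (S + B ** Y ** transpose B) \<le> h"
  obtains P where "psd P"
    "S \<bullet> (C + P) + \<beta> * mat_norm_1_1 (transpose B ** (C + P) ** B) \<le> h"
proof -
  define T where "T = {Y :: real^'k^'k. mat_norm_inf_inf Y \<le> \<beta> \<and> symmetric_matrix Y}"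
  define F where "F Y = S + B ** Y ** transpose B" for Y :: "real^'k^'k"
  \<comment> \<open>\<open>K\<close> contains nonsymmetric matrices, which forces the separating \<open>P\<close> to be symmetric.\<close>
  define K where "K = {Q :: real^'n^'n. \<forall>v. 0 \<le> v \<bullet> (Q *v v)}"
  \<comment> \<open>The origin in \<open>D\<close> would mean a feasible \<open>F Y\<close> whose
    objective exceeds \<open>h\<close> by some \<open>r > 0\<close>; \<open>bound\<close> excludes
    this.\<close>
  define D where "D = {(Q - F Y, h + r - C \<bullet> F Y) | Q Y r. Q \<in> K \<and> Y \<in> T \<and> 0 < r}"
  \<comment> \<open>\<open>F\<close> is affine rather than linear, so the weights must sum to
    1.\<close>
  have F_comb: "u *\<^sub>R F X + v *\<^sub>R F Y = F (u *\<^sub>R X + v *\<^sub>R Y)" if "u + v = 1" for u v X Y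
  proof -
    have "u *\<^sub>R S + v *\<^sub>R S = S" using that by (metis scaleR_left_distrib scaleR_one)
    then show ?thesis
      by (simp add: F_def matrix_add_ldistrib matrix_matrix_add_rdistrib
          scalar_matrix_assoc[symmetric] matrix_scalar_ac scaleR_add_right add_ac)
  qed
  have T_comb: "u *\<^sub>R X + v *\<^sub>R Y \<in> T" if "X \<in> T" "Y \<in> T" "0 \<le> u" "0 \<le> v" "u + v = 1" for u v X Y
  proof -
    have "\<bar>u * X $ i $ j + v * Y $ i $ j\<bar> \<le> \<beta>" for i j
    proof -
      have "\<bar>u * X $ i $ j + v * Y $ i $ j\<bar> \<le> u * \<bar>X $ i $ j\<bar> + v * \<bar>Y $ i $ j\<bar>"
        using abs_triangle_ineq[of "u * X $ i $ j" "v * Y $ i $ j"] that by (simp add: abs_mult)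
      also have "\<dots> \<le> \<beta>"
        using that by (intro convex_bound_le) (auto simp: T_def mat_norm_inf_inf_le_iff)
      finally show ?thesis .
    qed
    then show ?thesis
      using that by (simp add: T_def mat_norm_inf_inf_le_iff symmetric_matrix_iff)
  qed
  have K_comb: "u *\<^sub>R X + v *\<^sub>R Y \<in> K" if "X \<in> K" "Y \<in> K" "0 \<le> u" "0 \<le> v" for u v X Y
    using that by (simp add: K_def matrix_vector_mult_add_rdistrib inner_add_right
        scaleR_matrix_vector_assoc[symmetric])
  have "convex D"
    unfolding convex_def
  proof (intro ballI allI impI)
    fix x y and u v :: real
    assume xy: "x \<in> D" "y \<in> D" and uv: "0 \<le> u" "0 \<le> v" "u + v = 1"
    obtain Q X r where x: "x = (Q - F X, h + r - C \<bullet> F X)" "Q \<in> K" "X \<in> T" "0 < r"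
      using xy(1) unfolding D_def by blast
    obtain R Y s where y: "y = (R - F Y, h + s - C \<bullet> F Y)" "R \<in> K" "Y \<in> T" "0 < s"
      using xy(2) unfolding D_def by blast
    have v: "v = 1 - u" using uv by simp
    have rs: "0 < u * r + v * s"
      using x(4) y(4) uv by (cases "u = 0") (simp_all add: add_pos_nonneg)
    have "u *\<^sub>R x + v *\<^sub>R y =
      ((u *\<^sub>R Q + v *\<^sub>R R) - F (u *\<^sub>R X + v *\<^sub>R Y),
       h + (u * r + v * s) - C \<bullet> F (u *\<^sub>R X + v *\<^sub>R Y))"
      unfolding F_comb[OF uv(3), symmetric]
      by (simp add: x(1) y(1) inner_add_right v algebra_simps)
    then show "u *\<^sub>R x + v *\<^sub>R y \<in> D"
      unfolding D_def using K_comb[OF x(2) y(2) uv(1,2)] T_comb[OF x(3) y(3) uv] rs by blast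
  qed
  moreover have "0 \<notin> D"
  proof
    assume "0 \<in> D"
    then obtain Q Y r where *: "Q = F Y" "h + r = C \<bullet> F Y" "Q \<in> K" "Y \<in> T" "0 < r"
      unfolding D_def by (auto simp: zero_prod_def)
    have "symmetric_matrix (F Y)"
      using *(4) assms(1) unfolding F_def T_def pos_def_def
      by (intro symmetric_matrix_add symmetric_congruence) auto
    then have "psd (F Y)"
      using * by (simp add: psd_def K_def)
    then have "C \<bullet> F Y \<le> h"
      using bound *(4) by (simp add: F_def T_def)
    with * show False by simp
  qed
  ultimately obtain P l where nz: "(P, l) \<noteq> 0" and sep: "\<forall>x\<in>D. 0 \<le> (P, l) \<bullet> x"
    using separating_hyperplane_set_0 by (metis surj_pair)
  have sep': "0 \<le> P \<bullet> (Q - F Y) + l * (h + r - C \<bullet> F Y)" if "Q \<in> K" "Y \<in> T" "0 < r" for Q Y r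
    using sep that by (force simp: D_def)
  have T0: "0 \<in> T"
    using \<open>0 \<le> \<beta>\<close> by (simp add: T_def mat_norm_inf_inf_le_iff symmetric_matrix_iff)
  have F0: "F 0 = S" by (simp add: F_def)
  have S_psd: "psd S" using assms(1) by (rule pos_def_imp_psd)
  have SK: "S \<in> K" using S_psd by (simp add: K_def psd_def)
  \<comment> \<open>\<open>K\<close> is a cone: a negative product could be scaled until it
    outweighs the fixed remainder \<open>e\<close>.\<close>
  have PK: "0 \<le> P \<bullet> Q" if "Q \<in> K" for Q
  proof (rule ccontr)
    assume neg: "\<not> 0 \<le> P \<bullet> Q"
    define e where "e = P \<bullet> (0 - F 0) + l * (h + 1 - C \<bullet> F 0)"
    define t where "t = (\<bar>e\<bar> + 1) / - (P \<bullet> Q)"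
    have "0 \<le> t" unfolding t_def using neg by (intro divide_nonneg_pos) auto
    then have "t *\<^sub>R Q \<in> K"
      using that by (simp add: K_def scaleR_matrix_vector_assoc[symmetric])
    from sep'[OF this T0, of 1] have "0 \<le> t * (P \<bullet> Q) + e"
      by (simp add: e_def inner_diff_right)
    moreover have "t * (P \<bullet> Q) = - (\<bar>e\<bar> + 1)"
      using neg by (simp add: t_def)
    ultimately show False by linarith
  qed
  \<comment> \<open>Likewise \<open>r\<close> is unbounded above, so a negative \<open>l\<close>
    would make the separating functional negative.\<close>
  have l: "0 \<le> l"
  proof (rule ccontr)
    assume neg: "\<not> 0 \<le> l"
    define e where "e = l * (h - C \<bullet> S)"
    have "0 \<le> e + l * ((\<bar>e\<bar> + 1) / - l)"
      using sep'[OF SK T0, of "(\<bar>e\<bar> + 1) / - l"] neg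
      by (simp add: F0 e_def algebra_simps divide_pos_neg)
    moreover have "l * ((\<bar>e\<bar> + 1) / - l) = - (\<bar>e\<bar> + 1)"
      using neg by simp
    ultimately show False by linarith
  qed
  have "psd P"
    unfolding psd_def
  proof (intro conjI allI)
    show "symmetric_matrix P"
      using PK by (intro symmetric_of_inner_nonneg) (auto simp: K_def)
    show "0 \<le> v \<bullet> (P *v v)" for v
      using PK[of "outer_square v"] psd_outer_square[of v]
      by (simp add: inner_outer_square K_def psd_def)
  qed
  \<comment> \<open>Slater's condition: with \<open>l = 0\<close> the choice \<open>Q = 0\<close>,
    \<open>Y = 0\<close> gives \<open>P \<bullet> S \<le> 0\<close>, and positive definiteness of
    \<open>S\<close> forces \<open>P = 0\<close>.\<close>
  have "l \<noteq> 0"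
  proof
    assume "l = 0"
    moreover have "0 \<in> K" by (simp add: K_def)
    ultimately have "P \<bullet> S \<le> 0"
      using sep'[of 0 0 1] T0 by (simp add: F0)
    then have "P = 0" using psd_inner_pos_def_eq_0[OF \<open>psd P\<close> assms(1)] by simp
    with nz \<open>l = 0\<close> show False by (simp add: zero_prod_def)
  qed
  with l have l: "0 < l" by simp
  define R where "R = (1 / l) *\<^sub>R P"
  have "psd R"
    using \<open>psd P\<close> l by (simp add: R_def psd_def symmetric_matrix_iff scaleR_matrix_vector_assoc[symmetric])
  \<comment> \<open>With \<open>Q = 0\<close>, separation loses only \<open>r\<close>, which is
    arbitrarily small.\<close>
  have le: "F Y \<bullet> (C + R) \<le> h" if "Y \<in> T" for Y
  proof (rule field_le_epsilon)
    fix r :: real assume "0 < r"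
    then have "0 \<le> (P \<bullet> (0 - F Y) + l * (h + r - C \<bullet> F Y)) / l"
      using sep'[of 0 Y r] that l by (simp add: K_def)
    also have "\<dots> = h + r - F Y \<bullet> (C + R)"
      using l by (simp add: R_def inner_add_right inner_commute[of "F Y"] field_simps)
    finally show "F Y \<bullet> (C + R) \<le> h + r" by simp
  qed
  have "symmetric_matrix (C + R)"
    using \<open>psd R\<close> assms(2) by (intro symmetric_matrix_add) (auto simp: psd_def)
  then have "symmetric_matrix (transpose B ** (C + R) ** B)"
    by (metis symmetric_congruence transpose_transpose)
  \<comment> \<open>This worst \<open>Y\<close> may leave \<open>F Y\<close> indefinite: the
    multiplier \<open>R\<close> has absorbed that constraint, so \<open>le\<close> still
    applies.\<close>
  then obtain Y where Y: "mat_norm_inf_inf Y \<le> \<beta>" "symmetric_matrix Y"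
    "(transpose B ** (C + R) ** B) \<bullet> Y = \<beta> * mat_norm_1_1 (transpose B ** (C + R) ** B)"
    using mat_norm_1_1_attained[OF \<open>0 \<le> \<beta>\<close>] by blast
  then have "S \<bullet> (C + R) + \<beta> * mat_norm_1_1 (transpose B ** (C + R) ** B) = F Y \<bullet> (C + R)"
    by (simp add: F_def inner_add_left inner_congruence inner_commute[of Y])
  also have "\<dots> \<le> h" using Y by (intro le) (simp add: T_def)
  finally show ?thesis using that[of R] \<open>psd R\<close> by blast
qed

subsection \<open>Gaussian half-space probabilities\<close>

lemma std_normal_singleton: "measure std_normal_distribution {x} = 0"
proof -
  have "AE y in lborel. y \<noteq> x" by (rule AE_lborel_singleton)
  then have "emeasure std_normal_distribution {x} = 0"
    by (subst emeasure_density) (auto simp: nn_integral_0_iff_AE indicator_def elim!: eventually_mono)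
  then show ?thesis by (simp add: measure_def)
qed

lemma isCont_cdf_std_normal: "isCont (cdf std_normal_distribution) x"
proof -
  interpret real_distribution std_normal_distribution by (rule real_dist_normal_dist)
  show ?thesis by (simp add: isCont_cdf std_normal_singleton)
qed

text \<open>The density is positive everywhere, so an interval of positive length is not a null
  set.\<close>

lemma strict_mono_cdf_std_normal: "strict_mono (cdf std_normal_distribution)"
proof (rule strict_monoI)
  interpret real_distribution std_normal_distribution by (rule real_dist_normal_dist)
  fix x y :: real assume "x < y"
  have "emeasure std_normal_distribution {x<..y} \<noteq> 0"
  proof
    assume "emeasure std_normal_distribution {x<..y} = 0"
    then have "AE z in lborel. z \<notin> {x<..y}"
      by (subst (asm) emeasure_density)
        (auto simp: nn_integral_0_iff_AE indicator_def normal_density_pos[THEN less_imp_neq, symmetric]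
            normal_density_pos not_le elim!: eventually_mono split: if_splits)
    then have "emeasure lborel {x<..y} = 0"
      by (subst AE_iff_measurable[symmetric, where P="\<lambda>z. z \<notin> {x<..y}"]) auto
    then show False using \<open>x < y\<close> by simp
  qed
  then have "0 < measure std_normal_distribution {x<..y}"
    by (simp add: emeasure_eq_measure zero_less_measure_iff)
  then show "cdf std_normal_distribution x < cdf std_normal_distribution y"
    using cdf_diff_eq[OF \<open>x < y\<close>] by simp
qed

text \<open>The affine transformation rule with factor -1 shows that the law is invariant under
  negation; the absence of atoms allows passing from \<open>{..<x}\<close> to
  \<open>{..x}\<close>.\<close>

lemma cdf_std_normal_minus: "cdf std_normal_distribution (- x) = 1 - cdf std_normal_distribution x"
proof -
  interpret real_distribution std_normal_distribution by (rule real_dist_normal_dist)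
  have "distributed std_normal_distribution lborel (\<lambda>x. x) std_normal_density"
    by (simp add: distributed_def distr_id2)
  then have "distributed std_normal_distribution lborel (\<lambda>x. 0 + (- 1) * x)
    (normal_density (0 + (- 1) * 0) (\<bar>- 1\<bar> * 1))"
    by (intro normal_density_affine) auto
  then have "distr std_normal_distribution borel uminus = std_normal_distribution"
    by (simp add: distributed_def cong: distr_cong)
  then have "measure std_normal_distribution {..- x}
      = measure (distr std_normal_distribution borel uminus) {..- x}"
    by simp
  also have "\<dots> = prob {x..}"
    by (subst measure_distr) (auto intro!: arg_cong[where f = prob])
  also have "\<dots> = 1 - prob {..<x}"
    by (subst prob_compl[symmetric]) (auto intro!: arg_cong[where f = prob])
  also have "prob {..<x} = prob {..x}"
    using finite_measure_Union[of "{..<x}" "{x}"] std_normal_singleton[of x]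
    by (simp add: ivl_disj_un(2)[symmetric])
  finally show ?thesis by (simp add: cdf_def)
qed

text \<open>\<open>inv\<close> only chooses a preimage, so the point is that \<open>p\<close> is
  attained: by the limits at both ends and the intermediate value theorem.\<close>

lemma cdf_std_normal_inv:
  assumes "0 < p" "p < 1"
  shows "cdf std_normal_distribution (inv (cdf std_normal_distribution) p) = p"
proof -
  interpret real_distribution std_normal_distribution by (rule real_dist_normal_dist)
  obtain a where a: "cdf std_normal_distribution a < p"
    using order_tendstoD(2)[OF cdf_lim_at_bot \<open>0 < p\<close>]
    by (auto simp: eventually_at_bot_linorder)
  obtain b where b: "p < cdf std_normal_distribution b"
    using order_tendstoD(1)[OF cdf_lim_at_top_prob \<open>p < 1\<close>]
    by (auto simp: eventually_at_top_linorder)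
  have "a \<le> b" using a b cdf_nondecreasing[of b a] by linarith
  then obtain x where "cdf std_normal_distribution x = p"
    using IVT[of "cdf std_normal_distribution" a p b] a b isCont_cdf_std_normal by auto
  then show ?thesis by (intro f_inv_into_f) auto
qed

text \<open>Symmetry turns the value \<open>\<epsilon>\<close> at \<open>- \<kappa>\<close> into
  \<open>1 - \<epsilon>\<close> at \<open>\<kappa>\<close>; strict monotonicity does the
  rest.\<close>

lemma std_normal_quantile_bound:
  assumes "0 < \<epsilon>" "\<epsilon> < 1 / 2" and \<kappa>: "\<kappa> = - inv (cdf std_normal_distribution) \<epsilon>"
  shows "0 < \<kappa>" and "1 - \<epsilon> \<le> cdf std_normal_distribution x \<longleftrightarrow> \<kappa> \<le> x"
proof -
  have eps: "cdf std_normal_distribution (- \<kappa>) = \<epsilon>"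
    using cdf_std_normal_inv[of \<epsilon>] assms by simp
  then have 1: "cdf std_normal_distribution \<kappa> = 1 - \<epsilon>"
    using cdf_std_normal_minus[of \<kappa>] by simp
  then show "1 - \<epsilon> \<le> cdf std_normal_distribution x \<longleftrightarrow> \<kappa> \<le> x"
    using strict_mono_less_eq[OF strict_mono_cdf_std_normal] by metis
  have "cdf std_normal_distribution (- \<kappa>) < cdf std_normal_distribution \<kappa>"
    using eps 1 assms by simp
  then show "0 < \<kappa>"
    using strict_mono_less[OF strict_mono_cdf_std_normal] by fastforce
qed

text \<open>A linear combination of independent standard normals with coefficients \<open>b\<close>
  is normal with mean 0 and standard deviation \<open>norm b\<close>.\<close>

lemma prob_linear_std_normal:
  fixes b :: "real^'n"
  assumes "b \<noteq> 0"
  shows "measure (\<Pi>\<^sub>M i\<in>(UNIV :: 'n set). std_normal_distribution)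
      {\<xi> \<in> space (\<Pi>\<^sub>M i\<in>(UNIV :: 'n set). std_normal_distribution). b \<bullet> (\<chi> i. \<xi> i) \<le> y}
    = cdf std_normal_distribution (y / norm b)"
proof -
  define M where "M = (\<Pi>\<^sub>M i\<in>(UNIV :: 'n set). std_normal_distribution)"
  have std: "prob_space std_normal_distribution"
    using real_dist_normal_dist by (simp add: real_distribution_def)
  interpret prob_space M
    unfolding M_def by (intro prob_space_PiM std)
  have comp: "distr M borel (\<lambda>\<xi>. \<xi> i) = std_normal_distribution" for i
    using distr_PiM_component[of UNIV "\<lambda>_. std_normal_distribution" i] std
    by (simp add: M_def cong: distr_cong)
  have meas: "(\<lambda>\<xi>. \<xi> i) \<in> borel_measurable M" for i
    unfolding M_def by simp
  \<comment> \<open>The sum rule for normal variables requires positive standard deviations, hence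
    zero coefficients are dropped.\<close>
  define I where "I = {i. b $ i \<noteq> 0}"
  \<comment> \<open>Independence means that the joint law is the product of the marginals; here the
    joint law is \<open>M\<close> itself.\<close>
  have "indep_vars (\<lambda>_. borel) (\<lambda>i \<xi>. \<xi> i) (UNIV :: 'n set)"
  proof (subst indep_vars_iff_distr_eq_PiM)
    have "distr M (\<Pi>\<^sub>M i\<in>UNIV. borel) (\<lambda>\<xi>. \<lambda>i\<in>UNIV. \<xi> i) = distr M M (\<lambda>\<xi>. \<xi>)"
      by (intro distr_cong) (auto simp: M_def cong: sets_PiM_cong)
    then show "distr M (\<Pi>\<^sub>M i\<in>UNIV. borel) (\<lambda>\<xi>. \<lambda>i\<in>UNIV. \<xi> i)
        = (\<Pi>\<^sub>M i\<in>UNIV. distr M borel (\<lambda>\<xi>. \<xi> i))"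
      unfolding comp by (simp add: M_def[symmetric])
  qed (use meas in auto)
  then have "indep_vars (\<lambda>_. borel) (\<lambda>i \<xi>. b $ i * \<xi> i) (UNIV :: 'n set)"
    by (rule indep_vars_compose2) simp
  then have ind: "indep_vars (\<lambda>_. borel) (\<lambda>i \<xi>. b $ i * \<xi> i) I"
    by (rule indep_vars_subset) simp
  have dist: "distributed M lborel (\<lambda>\<xi>. b $ i * \<xi> i) (normal_density 0 \<bar>b $ i\<bar>)" if "i \<in> I" for i
  proof -
    have "distributed M lborel (\<lambda>\<xi>. \<xi> i) std_normal_density"
      using comp[of i] meas[of i] by (simp add: distributed_def)
        (metis distr_cong sets_lborel)
    then show ?thesis
      using normal_density_affine[of "\<lambda>\<xi>. \<xi> i" 0 1 "b $ i" 0] that by (simp add: I_def)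
  qed
  have sum_I: "(\<Sum>i\<in>I. b $ i * c i) = (\<Sum>i\<in>UNIV. b $ i * c i)" for c
    by (intro sum.mono_neutral_left) (auto simp: I_def)
  have "I \<noteq> {}" using assms by (auto simp: I_def vec_eq_iff)
  then have "distributed M lborel (\<lambda>\<xi>. \<Sum>i\<in>I. b $ i * \<xi> i)
      (normal_density (\<Sum>i\<in>I. 0) (sqrt (\<Sum>i\<in>I. \<bar>b $ i\<bar>\<^sup>2)))"
    using ind dist by (intro sum_indep_normal) (auto simp: I_def)
  moreover have "sqrt (\<Sum>i\<in>I. \<bar>b $ i\<bar>\<^sup>2) = norm b"
    using sum_I[of "\<lambda>i. b $ i"] by (simp add: norm_eq_sqrt_inner inner_vec_def power2_eq_square)
  ultimately have "distributed M lborel (\<lambda>\<xi>. \<Sum>i\<in>UNIV. b $ i * \<xi> i) (normal_density 0 (norm b))"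
    by (simp add: sum_I)
  then have "distributed M lborel (\<lambda>\<xi>. (\<Sum>i\<in>UNIV. b $ i * \<xi> i) / norm b) std_normal_density"
    using normal_standard_normal_convert[of "norm b" _ 0] assms by simp
  then have D: "distr M borel (\<lambda>\<xi>. (\<Sum>i\<in>UNIV. b $ i * \<xi> i) / norm b) = std_normal_distribution"
    by (simp add: distributed_def cong: distr_cong)
  have "cdf std_normal_distribution (y / norm b)
      = measure (distr M borel (\<lambda>\<xi>. (\<Sum>i\<in>UNIV. b $ i * \<xi> i) / norm b)) {..y / norm b}"
    by (simp add: D cdf_def)
  also have "\<dots> = measure M {\<xi> \<in> space M. (\<Sum>i\<in>UNIV. b $ i * \<xi> i) \<le> y}"
    using meas assms
    by (subst measure_distr) (auto intro!: arg_cong[where f = "measure M"] simp: divide_right_mono field_simps)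
  finally show ?thesis by (simp add: M_def inner_vec_def)
qed

text \<open>With \<open>b = transpose L *v a\<close> the random part is
  \<open>b \<bullet> \<xi>\<close>, whose variance is \<open>a \<bullet> (\<Sigma> *v a)\<close> for
  whichever factor \<open>L\<close> was chosen.\<close>

lemma multivariate_normal_chance_constraint:
  fixes a \<mu> :: "real^'n"
  assumes "\<exists>L :: real^'n^'n. L ** transpose L = \<Sigma>"
    and "0 < \<epsilon>" "\<epsilon> < 1 / 2" "\<kappa> = - inv (cdf std_normal_distribution) \<epsilon>"
  shows "1 - \<epsilon> \<le> measure (multivariate_normal \<mu> \<Sigma>) {\<zeta>. c + a \<bullet> \<zeta> \<le> 0} \<longleftrightarrow>
    c + a \<bullet> \<mu> + \<kappa> * sqrt (a \<bullet> (\<Sigma> *v a)) \<le> 0"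
proof -
  define M where "M = (\<Pi>\<^sub>M i\<in>(UNIV :: 'n set). std_normal_distribution)"
  define L where "L = (SOME L :: real^'n^'n. L ** transpose L = \<Sigma>)"
  define b where "b = transpose L *v a"
  have L: "L ** transpose L = \<Sigma>"
    unfolding L_def by (rule someI_ex) (rule assms(1))
  have quad: "a \<bullet> (\<Sigma> *v a) = (norm b)\<^sup>2"
    by (simp add: L[symmetric] matrix_vector_mul_assoc[symmetric] inner_matrix_vector_transpose
        power2_norm_eq_inner b_def)
  have lin: "a \<bullet> (\<mu> + L *v \<xi>) = a \<bullet> \<mu> + b \<bullet> \<xi>" for \<xi>
    by (simp add: inner_add_right inner_matrix_vector_transpose b_def)
  have "(\<lambda>\<xi>. \<mu> + L *v (\<chi> i. \<xi> i)) \<in> borel_measurable M"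
    by (subst borel_measurable_euclidean_space)
      (auto simp: M_def Basis_vec_def inner_axis matrix_vector_mult_def)
  then have eq: "measure (multivariate_normal \<mu> \<Sigma>) {\<zeta>. c + a \<bullet> \<zeta> \<le> 0}
      = measure M {\<xi> \<in> space M. b \<bullet> (\<chi> i. \<xi> i) \<le> - (c + a \<bullet> \<mu>)}"
    unfolding multivariate_normal_def Let_def M_def[symmetric] L_def[symmetric]
    by (subst measure_distr) (auto simp: lin intro!: arg_cong[where f = "measure M"])
  show ?thesis
  proof (cases "b = 0")
    \<comment> \<open>Without variance the event has probability 1 or 0, according to whether
      \<open>c + a \<bullet> \<mu> \<le> 0\<close>, and \<open>1 - \<epsilon>\<close> lies strictly
      between.\<close>
    case True
    interpret prob_space M
      using real_dist_normal_dist unfolding M_def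
      by (intro prob_space_PiM) (simp add: real_distribution_def)
    have "a \<bullet> \<mu> \<le> - c \<longleftrightarrow> c + a \<bullet> \<mu> \<le> 0" by linarith
    then show ?thesis
      using True assms(2,3) by (cases "c + a \<bullet> \<mu> \<le> 0") (simp_all add: eq quad prob_space)
  next
    case False
    then show ?thesis
      using std_normal_quantile_bound(2)[OF assms(2-4)]
      unfolding eq unfolding M_def prob_linear_std_normal[OF False]
      by (simp add: quad field_simps) linarith
  qed
qed

subsection \<open>The robust chance constraint\<close>

theorem theorem3p2:
  fixes \<epsilon> \<kappa> \<alpha> \<beta> :: real
    and g :: "real^'n \<Rightarrow> real"
    and X :: "(real^'n) set"
    and \<mu>t xt :: "real^'n"
    and \<Sigma>t :: "real^'n^'n"
    and A :: "real^'m^'n"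
    and B :: "real^'k^'n"
    and U\<mu> :: "(real^'n) set"
    and U\<Sigma> :: "(real^'n^'n) set"
  assumes "0 < \<epsilon>" and "\<epsilon> < 1/2"
    and "\<kappa> = - inv (cdf std_normal_distribution) \<epsilon>"
    and "\<forall>x. g differentiable (at x)"
    and "closed X"
    and "pos_def \<Sigma>t"
    and "0 \<le> \<alpha>" and "0 \<le> \<beta>"
    and "U\<mu> = {\<mu>t + A *v z1 | z1 :: real^'m. infnorm z1 \<le> \<alpha>}"
    and "U\<Sigma> = {\<Sigma>t + B ** Z2 ** transpose B | Z2 :: real^'k^'k.
                  mat_norm_inf_inf Z2 \<le> \<beta> \<and> symmetric_matrix Z2} \<inter> {Z. psd Z}"
    and "xt \<in> X"
  shows "(\<forall>\<mu>\<in>U\<mu>. \<forall>\<Sigma>\<in>U\<Sigma>.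
            measure (multivariate_normal \<mu> \<Sigma>) {\<zeta>. g xt + gradient g xt \<bullet> \<zeta> \<le> 0} \<ge> 1 - \<epsilon>)
     \<longleftrightarrow> (\<exists>z::real. \<exists>W::real^'n^'n. symmetric_matrix W \<and>
            g xt + gradient g xt \<bullet> \<mu>t + \<alpha> * vec_norm_1 (transpose A *v gradient g xt)
              + mat_inner \<Sigma>t W + \<beta> * mat_norm_1_1 (transpose B ** W ** B) + \<kappa>\<^sup>2 * z \<le> 0 \<and>
            psd (bordered_matrix W (gradient g xt /\<^sub>R 2) z))"
proof -
  define a where "a = gradient g xt"
  \<comment> \<open>The worst case over \<open>U\<mu>\<close> of the deterministic part; it is
    attained, so the quantifier over \<open>\<mu>\<close> can be eliminated.\<close>
  define s where "s = g xt + a \<bullet> \<mu>t + \<alpha> * vec_norm_1 (transpose A *v a)"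
  have \<kappa>: "0 < \<kappa>" using std_normal_quantile_bound(1) assms(1-3) by blast
  have psd: "psd \<Sigma>" if "\<Sigma> \<in> U\<Sigma>" for \<Sigma>
    using that assms(10) by simp
  have "(\<forall>\<mu>\<in>U\<mu>. \<forall>\<Sigma>\<in>U\<Sigma>. measure (multivariate_normal \<mu> \<Sigma>) {\<zeta>. g xt + a \<bullet> \<zeta> \<le> 0} \<ge> 1 - \<epsilon>)
    \<longleftrightarrow> (\<forall>\<mu>\<in>U\<mu>. \<forall>\<Sigma>\<in>U\<Sigma>. g xt + a \<bullet> \<mu> + \<kappa> * sqrt (a \<bullet> (\<Sigma> *v a)) \<le> 0)"
    using multivariate_normal_chance_constraint[OF psd_factorization[OF psd] assms(1-3)] by simp
  also have "\<dots> \<longleftrightarrow> (\<forall>\<Sigma>\<in>U\<Sigma>. s + \<kappa> * sqrt (a \<bullet> (\<Sigma> *v a)) \<le> 0)"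
  proof -
    have mu: "a \<bullet> (\<mu>t + A *v y) = a \<bullet> \<mu>t + (transpose A *v a) \<bullet> y" for y
      by (simp add: inner_add_right inner_matrix_vector_transpose)
    obtain y where y: "infnorm y \<le> \<alpha>"
      "(transpose A *v a) \<bullet> y = \<alpha> * vec_norm_1 (transpose A *v a)"
      using vec_norm_1_attained[OF \<open>0 \<le> \<alpha>\<close>] by blast
    have "\<mu>t + A *v y \<in> U\<mu>" "g xt + a \<bullet> (\<mu>t + A *v y) = s"
      using y assms(9) by (auto simp: mu s_def)
    moreover have "g xt + a \<bullet> \<mu> \<le> s" if "\<mu> \<in> U\<mu>" for \<mu>
      using that assms(9) inner_le_vec_norm_1[of _ \<alpha> "transpose A *v a"]
      by (auto simp: mu s_def)
    ultimately show ?thesis by (smt (verit))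
  qed
  also have "\<dots> \<longleftrightarrow> (\<exists>z W. symmetric_matrix W \<and>
      s + mat_inner \<Sigma>t W + \<beta> * mat_norm_1_1 (transpose B ** W ** B) + \<kappa>\<^sup>2 * z \<le> 0 \<and>
      psd (bordered_matrix W (a /\<^sub>R 2) z))" (is "?robust \<longleftrightarrow> ?sdp")
  proof
    assume ?sdp
    then obtain z W where W: "symmetric_matrix W" "psd (bordered_matrix W (a /\<^sub>R 2) z)"
      "s + \<Sigma>t \<bullet> W + \<beta> * mat_norm_1_1 (transpose B ** W ** B) + \<kappa>\<^sup>2 * z \<le> 0"
      unfolding mat_inner_eq_inner by blast
    show ?robust
    proof
      fix \<Sigma> assume "\<Sigma> \<in> U\<Sigma>"
      then obtain Y :: "real^'k^'k" where Y: "mat_norm_inf_inf Y \<le> \<beta>" "psd \<Sigma>"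
        "\<Sigma> = \<Sigma>t + B ** Y ** transpose B"
        using assms(10) by auto
      have "\<Sigma> \<bullet> W \<le> \<Sigma>t \<bullet> W + \<beta> * mat_norm_1_1 (transpose B ** W ** B)"
        using inner_le_mat_norm_1_1[OF Y(1), of "transpose B ** W ** B"]
        by (simp add: Y(3) inner_add_left inner_congruence inner_commute[of Y])
      then show "s + \<kappa> * sqrt (a \<bullet> (\<Sigma> *v a)) \<le> 0"
        using sdp_weak_duality[OF Y(2) W(1,2), of \<kappa>] W(3) by simp
    qed
  next
    assume robust: ?robust
    have \<Sigma>t: "\<Sigma>t \<in> U\<Sigma>"
      using assms(6,8) unfolding assms(10)
      by (auto simp: pos_def_imp_psd mat_norm_inf_inf_le_iff symmetric_matrix_iff intro!: exI[of _ 0])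
    \<comment> \<open>For \<open>a = 0\<close> the value \<open>s = 0\<close> is possible, and then
      the general \<open>z\<close> would vanish; the zero certificate serves instead.\<close>
    show ?sdp
    proof (cases "a = 0")
      case True
      then have "s \<le> 0" using robust \<Sigma>t by auto
      moreover have "psd (bordered_matrix (0 :: real^'n^'n) (0 /\<^sub>R 2) 0)"
        by (intro psd_bordered_matrixI) (auto simp: symmetric_matrix_iff)
      ultimately show ?thesis
        using True by (intro exI[of _ 0]) (simp add: symmetric_matrix_iff mat_norm_1_1_def mat_inner_eq_inner)
    next
      case False
      \<comment> \<open>The largest variance that the robust constraint allows:
        \<open>\<kappa> * sqrt h = - s\<close>.\<close>
      define h where "h = (s / \<kappa>)\<^sup>2"
      have "0 < a \<bullet> (\<Sigma>t *v a)"
        using False assms(6) by (simp add: pos_def_def)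
      \<comment> \<open>Strict because the nominal \<open>\<Sigma>t\<close> already has positive
        variance along \<open>a\<close>; this makes \<open>z\<close> positive.\<close>
      then have s: "s < 0"
        using robust \<Sigma>t \<kappa> by (smt (verit) mult_pos_pos real_sqrt_gt_zero)
      have "outer_square a \<bullet> \<Sigma> \<le> h" if "\<Sigma> \<in> U\<Sigma>" for \<Sigma>
      proof -
        have "sqrt (a \<bullet> (\<Sigma> *v a)) \<le> - s / \<kappa>"
          using robust that \<kappa> by (auto simp: field_simps)
        then have "(sqrt (a \<bullet> (\<Sigma> *v a)))\<^sup>2 \<le> (- s / \<kappa>)\<^sup>2"
          using psd[OF that] by (intro power_mono) (auto simp: psd_def)
        then show ?thesis
          using psd[OF that] by (simp add: inner_outer_square' h_def psd_def power_divide)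
      qed
      then obtain P where P: "psd P"
        "\<Sigma>t \<bullet> (outer_square a + P) + \<beta> * mat_norm_1_1 (transpose B ** (outer_square a + P) ** B) \<le> h"
        using sdp_strong_duality[OF assms(6) symmetric_outer_square assms(8), of B a h]
        unfolding assms(10) by blast
      \<comment> \<open>The minimizer of \<open>h / (4 * z) + \<kappa>\<^sup>2 * z\<close> over
        \<open>z > 0\<close>; the minimum is \<open>- s\<close>.\<close>
      define z where "z = - s / (2 * \<kappa>\<^sup>2)"
      define W where "W = (1 / (4 * z)) *\<^sub>R (outer_square a + P)"
      have z: "0 < z" using s \<kappa> by (simp add: z_def divide_neg_pos)
      have symW: "symmetric_matrix W"
        using P(1) symmetric_outer_square[of a] by (simp add: W_def psd_def symmetric_matrix_iff)
      have "\<Sigma>t \<bullet> W + \<beta> * mat_norm_1_1 (transpose B ** W ** B) =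
        (\<Sigma>t \<bullet> (outer_square a + P) + \<beta> * mat_norm_1_1 (transpose B ** (outer_square a + P) ** B)) / (4 * z)"
        using z by (simp add: W_def matrix_scalar_ac scalar_matrix_assoc[symmetric] mat_norm_1_1_scaleR
            add_divide_distrib)
      also have "\<dots> \<le> h / (4 * z)"
        using P(2) z by (intro divide_right_mono) auto
      also have "\<dots> + \<kappa>\<^sup>2 * z = - s"
        using s \<kappa> by (simp add: h_def z_def power2_eq_square field_simps)
      finally have le: "s + \<Sigma>t \<bullet> W + \<beta> * mat_norm_1_1 (transpose B ** W ** B) + \<kappa>\<^sup>2 * z \<le> 0"
        by simp
      have "psd (bordered_matrix W (a /\<^sub>R 2) z)"
      proof (rule psd_bordered_matrixI[OF symW])
        fix x t
        \<comment> \<open>Completing the square in \<open>t\<close>: the part of \<open>W\<close>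
          from \<open>outer_square a\<close> supplies the square, and \<open>P\<close> the
          remainder.\<close>
        have "0 \<le> x \<bullet> (P *v x) / (4 * z) + z * (t + (a \<bullet> x) / (2 * z))\<^sup>2"
          using P(1) z by (simp add: psd_def)
        also have "\<dots> = x \<bullet> (W *v x) + 2 * t * ((a /\<^sub>R 2) \<bullet> x) + z * t\<^sup>2"
          using z by (simp add: W_def scaleR_matrix_vector_assoc[symmetric] matrix_vector_mult_add_rdistrib
              outer_square_mult_vec inner_add_right inner_commute[of x a] power2_eq_square field_simps)
        finally show "0 \<le> x \<bullet> (W *v x) + 2 * t * ((a /\<^sub>R 2) \<bullet> x) + z * t\<^sup>2" .
      qed
      with symW le show ?thesis unfolding mat_inner_eq_inner by blast
    qed
  qed
  finally show ?thesis by (simp only: a_def s_def)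
qed

end
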